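(* Let $T\in\mathbb{R}_+$, $A\in\mathbb{R}^{n\times n}$, $B\in\mathbb{R}^{n\times m}$, $F\in\mathbb{R}^{n\times l}_+$, $E\in\mathbb{R}^{m\times n}_+$ with no zero row, $s\in\mathbb{R}^n$, $r\in\mathbb{R}^m$, $\gamma\in\mathbb{R}^l_+$, with $A-|B|E$ Metzler and $s\ge E^{\top}|r|$. For $\Theta\in\{T,\infty\}$ consider the problem $$\inf_{\mu}\sup_{w}\int_0^{\Theta}[s^{\top}x+r^{\top}u-\gamma^{\top}w]\,d\tau\quad\text{s.t. } \dot x=Ax+Bu+Fw,\ x(0)=x_0,\ u(t)=\mu(x(t)),\ |u|\le Ex,\ w\ge 0. \qquad (P_\Theta)$$ Assume that the following conditions hold: (a) (finite horizon) $(P_T)$ has a finite optimal value for every $x_0\in\mathbb{R}^n_+$, and equivalently the differential equation $-\dot p(t)=s+A^{\top}p(t)-E^{\top}|r+B^{\top}p(t)|$, $p(T)=0$, has a unique solution and $\gamma\ge F^{\top}p(0)$; (b) (infinite horizon) $(P_\infty)$ has a finite value for every $x_0\in\mathbb{R}^n_+$, and equivalently there exists a unique $p\in\mathbb{R}^n_+$ which satisfies $0=s+A^{\top}p-E^{\top}|r+B^{\top}p|$ and $\gamma\ge F^{\top}p$ and which is elementwise minimal among all solutions in $\mathbb{R}^n_+$ of these relations. Let $h\in\mathbb{R}$ be such that $A-|B|E+hI_n\ge 0$ and $h>0$. Suppose also that $$(s^{\top}-|r^{\top}|E)\sum_{i=0}^{n-1}\left(\frac1h(A-|B|E)+I_n\right)^i>0.$$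 Then $(s^{\top}-r^{\top}K,\ A-BK)$ is detectable for any $K\in\mathbb{R}^{m\times n}$ satisfying $|K|\le E$.
   Context: Inequalities between vectors or matrices are elementwise ($>0$ means all entries strictly positive), $|X|$ denotes the elementwise absolute value, and $\mathbb{R}^n_+$, $\mathbb{R}^{m\times n}_+$ denote vectors/matrices with nonnegative entries. A square matrix is Metzler if its off-diagonal entries are nonnegative. $I_n$ is the $n\times n$ identity. A pair $(C,M)$ (system $\dot x=Mx$, $y=Cx$) is detectable if all unobservable states are (asymptotically) stable. In the control problems, $\mu$ ranges over all (potentially nonlinear and time-varying) state-feedback policies producing $u(t)\in\mathbb{R}^m$ with $|u(t)|\le Ex(t)$, and $w$ ranges over all nonnegative disturbance functions of time with values in $\mathbb{R}^l$ for which the dynamics and cost are well defined.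
   Formalization: Detectability is proved only for states in the nonnegative orthant: every nonnegative unobservable state is stable. For all of R^n the claim is false: A=0, B=E=F=I (n=2), s=γ=(1,1), r=0, h=2, K=-I has the unobservable unstable state (1,-1). *)

theory Defs
  imports "HOL-Analysis.Analysis"
begin

text \<open>
  On \<open>real^'n\<close> and \<open>real^'n^'m\<close> the library's \<open>\<le>\<close> and \<open>\<bar>_\<bar>\<close> are elementwise, but \<open><\<close> means
  ``\<open>\<le>\<close> and not \<open>\<ge>\<close>''; strict elementwise inequalities are therefore written out below.
\<close>

definition metzler :: "real^'n^'n \<Rightarrow> bool" where
  "metzler M \<longleftrightarrow> (\<forall>i j. i \<noteq> j \<longrightarrow> 0 \<le> M $ i $ j)"

text \<open>The library operation \<open>M ^ k\<close> on \<open>real^'n^'n\<close> is the elementwise power, not the matrix power.\<close>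

definition matpow :: "real^'n^'n \<Rightarrow> nat \<Rightarrow> real^'n^'n" where
  "matpow M k = (((**) M) ^^ k) (mat 1)"

subsection \<open>The minimax problem\<close>

text \<open>
  A problem is posed on a time set \<open>S\<close>, which is \<open>{0..T}\<close> or \<open>{0..}\<close>. Trajectories are
  Caratheodory solutions: the integral equation below makes \<open>x\<close> (locally) absolutely continuous
  with \<open>x' = A x + B u + F w\<close> almost everywhere, so that the sign-switching feedback laws
  which are optimal for such problems are not excluded.
\<close>

definition disturbance :: "real set \<Rightarrow> (real \<Rightarrow> real^'l) \<Rightarrow> bool" where
  "disturbance S w \<longleftrightarrow> (\<forall>t\<in>S. 0 \<le> w t) \<and> (\<forall>t\<in>S. w absolutely_integrable_on {0..t})"

definition closed_loop ::
  "real^'n^'n \<Rightarrow> real^'m^'n \<Rightarrow> real^'l^'n \<Rightarrow> real set \<Rightarrow> (real \<Rightarrow> real^'n \<Rightarrow> real^'m) \<Rightarrow>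
   (real \<Rightarrow> real^'l) \<Rightarrow> real^'n \<Rightarrow> (real \<Rightarrow> real^'n) \<Rightarrow> bool" where
  "closed_loop A B F S \<mu> w x0 x \<longleftrightarrow>
     x 0 = x0 \<and>
     (\<forall>t\<in>S. (\<lambda>\<tau>. \<mu> \<tau> (x \<tau>)) absolutely_integrable_on {0..t} \<and>
        ((\<lambda>\<tau>. A *v x \<tau> + B *v \<mu> \<tau> (x \<tau>) + F *v w \<tau>) has_integral (x t - x0)) {0..t})"

text \<open>
  A policy must be well posed, that is, react to every disturbance. Without this requirement a
  policy whose closed loop has no trajectory at all would make the inner supremum range over the
  empty set and bring the value of every problem down to \<open>-\<infinity>\<close>.
\<close>

definition admissible_policy ::
  "real^'n^'n \<Rightarrow> real^'m^'n \<Rightarrow> real^'n^'m \<Rightarrow> real^'l^'n \<Rightarrow> real set \<Rightarrow> real^'n \<Rightarrow>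
   (real \<Rightarrow> real^'n \<Rightarrow> real^'m) \<Rightarrow> bool" where
  "admissible_policy A B E F S x0 \<mu> \<longleftrightarrow>
     (\<forall>w. disturbance S w \<longrightarrow>
        (\<exists>x. closed_loop A B F S \<mu> w x0 x) \<and>
        (\<forall>x. closed_loop A B F S \<mu> w x0 x \<longrightarrow> (\<forall>t\<in>S. \<bar>\<mu> t (x t)\<bar> \<le> E *v x t)))"

definition running_cost ::
  "real^'n \<Rightarrow> real^'m \<Rightarrow> real^'l \<Rightarrow> (real \<Rightarrow> real^'n \<Rightarrow> real^'m) \<Rightarrow> (real \<Rightarrow> real^'l) \<Rightarrow>
   (real \<Rightarrow> real^'n) \<Rightarrow> real \<Rightarrow> real" where
  "running_cost s r \<gamma> \<mu> w x t = s \<bullet> x t + r \<bullet> \<mu> t (x t) - \<gamma> \<bullet> w t"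

text \<open>
  Costs are extended real, since over an infinite horizon they may diverge. They are the difference
  of the integrals of the positive and the negative part (\<open>ennreal\<close> truncates at \<open>0\<close>), and are
  well defined unless both of these are infinite.
\<close>

definition pos_integral :: "real set \<Rightarrow> (real \<Rightarrow> real) \<Rightarrow> ennreal" where
  "pos_integral S f = (\<integral>\<^sup>+ t\<in>S. ennreal (f t) \<partial>lebesgue)"

definition ext_integral :: "real set \<Rightarrow> (real \<Rightarrow> real) \<Rightarrow> ereal" where
  "ext_integral S f = enn2ereal (pos_integral S f) - enn2ereal (pos_integral S (\<lambda>t. - f t))"

definition ext_integral_well_defined :: "real set \<Rightarrow> (real \<Rightarrow> real) \<Rightarrow> bool" where
  "ext_integral_well_defined S f \<longleftrightarrow>
     pos_integral S f < \<infinity> \<or> pos_integral S (\<lambda>t. - f t) < \<infinity>"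

definition minimax_value ::
  "real^'n^'n \<Rightarrow> real^'m^'n \<Rightarrow> real^'n^'m \<Rightarrow> real^'l^'n \<Rightarrow> real^'n \<Rightarrow> real^'m \<Rightarrow> real^'l \<Rightarrow>
   real set \<Rightarrow> real^'n \<Rightarrow> ereal" where
  "minimax_value A B E F s r \<gamma> S x0 =
     (INF \<mu> \<in> {\<mu>. admissible_policy A B E F S x0 \<mu>}.
        SUP (w, x) \<in> {(w, x). disturbance S w \<and> closed_loop A B F S \<mu> w x0 x \<and>
                            ext_integral_well_defined S (running_cost s r \<gamma> \<mu> w x)}.
          ext_integral S (running_cost s r \<gamma> \<mu> w x))"

definition bellman_ode_solution ::
  "real^'n^'n \<Rightarrow> real^'m^'n \<Rightarrow> real^'n^'m \<Rightarrow> real^'n \<Rightarrow> real^'m \<Rightarrow> real \<Rightarrow> (real \<Rightarrow> real^'n) \<Rightarrow> bool" where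
  "bellman_ode_solution A B E s r T p \<longleftrightarrow>
     (\<forall>t\<in>{0..T}. (p has_vector_derivative
        - (s + transpose A *v p t - transpose E *v \<bar>r + transpose B *v p t\<bar>)) (at t within {0..T})) \<and>
     p T = 0"

definition bellman_equation_solution ::
  "real^'n^'n \<Rightarrow> real^'m^'n \<Rightarrow> real^'n^'m \<Rightarrow> real^'l^'n \<Rightarrow> real^'n \<Rightarrow> real^'m \<Rightarrow> real^'l \<Rightarrow>
   real^'n \<Rightarrow> bool" where
  "bellman_equation_solution A B E F s r \<gamma> p \<longleftrightarrow>
     0 \<le> p \<and>
     0 = s + transpose A *v p - transpose E *v \<bar>r + transpose B *v p\<bar> \<and>
     transpose F *v p \<le> \<gamma>"

subsection \<open>Detectability\<close>

definition linear_trajectory :: "real^'n^'n \<Rightarrow> real^'n \<Rightarrow> (real \<Rightarrow> real^'n) \<Rightarrow> bool" where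
  "linear_trajectory M x0 x \<longleftrightarrow>
     x 0 = x0 \<and> (\<forall>t\<ge>0. (x has_vector_derivative M *v x t) (at t within {0..}))"

definition unobservable_state :: "real^'n^'q \<Rightarrow> real^'n^'n \<Rightarrow> real^'n \<Rightarrow> bool" where
  "unobservable_state C M x0 \<longleftrightarrow>
     (\<exists>x. linear_trajectory M x0 x \<and> (\<forall>t\<ge>0. C *v x t = 0))"

definition asymptotically_stable_state :: "real^'n^'n \<Rightarrow> real^'n \<Rightarrow> bool" where
  "asymptotically_stable_state M x0 \<longleftrightarrow>
     (\<forall>x. linear_trajectory M x0 x \<longrightarrow> (x \<longlongrightarrow> 0) at_top)"

text \<open>
  All unobservable states of the system \<open>x' = M x\<close>, \<open>y = C x\<close> with state set \<open>X\<close> are stable. For a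
  general linear system \<open>X = UNIV\<close>; a positive system (\<open>M\<close> Metzler) lives on \<open>X = {x. 0 \<le> x}\<close>, which
  is invariant under its dynamics. The two notions differ: with \<open>C = (1, 1)\<close> and \<open>M\<close> the \<open>2 \<times> 2\<close>
  identity, the state \<open>(1, -1)\<close> is unobservable and unstable, but no nonzero nonnegative
  state is unobservable.
\<close>

definition detectable_on :: "(real^'n) set \<Rightarrow> real^'n^'q \<Rightarrow> real^'n^'n \<Rightarrow> bool" where
  "detectable_on X C M \<longleftrightarrow>
     (\<forall>x0\<in>X. unobservable_state C M x0 \<longrightarrow> asymptotically_stable_state M x0)"

end

theory Submission
  imports Defs
begin

text \<open>
  Put \<open>N = (A - B K) / h + I\<close> and \<open>P = (A - |B| E) / h + I\<close>, so that \<open>0 \<le> P \<le> N\<close>. An identically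
  vanishing output \<open>c \<bullet> x\<close> with \<open>c = s - r K\<close> can be differentiated, whence \<open>c N\<^sup>k \<bullet> x0 = 0\<close> for all
  \<open>k\<close>. For \<open>x0 \<ge> 0\<close> this dominates \<open>d P\<^sup>k \<bullet> x0 \<ge> 0\<close>, where \<open>d = s - |r| E \<ge> 0\<close>; as the row vector
  \<open>d \<Sum>\<^sub>k P\<^sup>k\<close> is strictly positive, \<open>x0 = 0\<close>. So the only nonnegative unobservable state is the
  equilibrium \<open>0\<close>.
\<close>

text \<open>An energy estimate of Gronwall type: with \<open>L\<close> the operator norm of
  \<open>M\<close>, the derivative of \<open>x \<bullet> x\<close> is at most
  \<open>2 * L * (x \<bullet> x)\<close>, so the weighted energy \<open>g\<close> cannot increase
  from its initial value 0. Stability of a state quantifies over all its trajectories, hence this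
  uniqueness result for the equilibrium.\<close>

lemma linear_trajectory_zero:
  fixes M :: "real^'n^'n"
  assumes "linear_trajectory M 0 x" "0 \<le> t"
  shows "x t = 0"
proof -
  define L where "L = onorm ((*v) M)"
  define g where "g \<tau> = exp (- 2 * L * \<tau>) * (x \<tau> \<bullet> x \<tau>)" for \<tau>
  have x0: "x 0 = 0"
    using assms(1) by (simp add: linear_trajectory_def)
  have der: "(x has_vector_derivative M *v x \<tau>) (at \<tau> within {0..})" if "0 \<le> \<tau>" for \<tau>
    using assms(1) that by (auto simp: linear_trajectory_def)
  have growth: "x \<tau> \<bullet> (M *v x \<tau>) \<le> L * (x \<tau> \<bullet> x \<tau>)" for \<tau>
  proof -
    have "x \<tau> \<bullet> (M *v x \<tau>) \<le> norm (x \<tau>) * norm (M *v x \<tau>)"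
      by (rule norm_cauchy_schwarz)
    also have "\<dots> \<le> norm (x \<tau>) * (L * norm (x \<tau>))"
      unfolding L_def by (intro mult_left_mono onorm matrix_vector_mul_bounded_linear norm_ge_zero)
    finally show ?thesis
      by (simp add: dot_square_norm power2_eq_square algebra_simps)
  qed
  have gder: "(g has_real_derivative
      2 * exp (- 2 * L * \<tau>) * (x \<tau> \<bullet> (M *v x \<tau>) - L * (x \<tau> \<bullet> x \<tau>))) (at \<tau> within {0..})"
    if "0 \<le> \<tau>" for \<tau>
  proof -
    have "((\<lambda>\<tau>. x \<tau> \<bullet> x \<tau>) has_real_derivative 2 * (x \<tau> \<bullet> (M *v x \<tau>))) (at \<tau> within {0..})"
      using has_derivative_inner[OF der[OF that, unfolded has_vector_derivative_def]
          der[OF that, unfolded has_vector_derivative_def]]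
      by (simp add: has_field_derivative_def inner_commute algebra_simps mult_commute_abs)
    then show ?thesis
      unfolding g_def by (auto intro!: derivative_eq_intros simp: algebra_simps)
  qed
  have "g t \<le> g 0"
  \<comment> \<open>At time 0 only a one-sided derivative exists, so the sign of the derivative is
    used on the open interval and continuity covers the endpoints.\<close>
  proof (rule DERIV_nonpos_imp_decreasing_open[OF \<open>0 \<le> t\<close>])
    fix \<tau> assume "0 < \<tau>" "\<tau> < t"
    then have "at \<tau> within {0..} = at \<tau>"
      by (intro at_within_interior) simp
    moreover have "2 * exp (- 2 * L * \<tau>) * (x \<tau> \<bullet> (M *v x \<tau>) - L * (x \<tau> \<bullet> x \<tau>)) \<le> 0"
      using growth[of \<tau>] by (intro mult_nonneg_nonpos) auto
    ultimately show "\<exists>y. DERIV g \<tau> :> y \<and> y \<le> 0"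
      using gder[of \<tau>] \<open>0 < \<tau>\<close> by auto
  next
    have "continuous_on {0..} g"
      by (rule DERIV_continuous_on) (use gder in auto)
    then show "continuous_on {0..t} g"
      by (rule continuous_on_subset) auto
  qed
  then have "g t \<le> 0"
    by (simp add: g_def x0)
  then show ?thesis
    by (simp add: g_def mult_le_0_iff dot_square_norm)
qed

lemma inner_linear_trajectory_zero:
  fixes M :: "real^'n^'n"
  assumes x: "linear_trajectory M x0 x" and y: "\<forall>t\<ge>0. y \<bullet> x t = 0"
  shows "\<forall>t\<ge>0. (y v* M) \<bullet> x t = 0"
proof (intro allI impI)
  fix t :: real assume t: "0 \<le> t"
  have "((\<lambda>\<tau>. y \<bullet> x \<tau>) has_vector_derivative y \<bullet> (M *v x t)) (at t within {0..})"
    using x t unfolding linear_trajectory_def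
    by (auto intro: bounded_linear.has_vector_derivative[OF bounded_linear_inner_right])
  then have "((\<lambda>\<tau>. 0) has_vector_derivative y \<bullet> (M *v x t)) (at t within {0..})"
    using t y by (auto elim!: has_vector_derivative_transform[rotated 2])
  moreover have "at t within {0..} \<noteq> bot"
    \<comment> \<open>The derivative within \<open>{0..}\<close> is unique, even at
      \<open>t = 0\<close>, because every point of the half-line is one of its limit points.\<close>
    using islimpt_subset[of t "{t..t + 1}" "{0..}"] t
    by (auto simp: trivial_limit_within)
  ultimately have "y \<bullet> (M *v x t) = 0"
    using has_vector_derivative_const vector_derivative_unique_within by blast
  then show "(y v* M) \<bullet> x t = 0"
    by (simp add: dot_lmul_matrix)
qed

text \<open>The row vectors that annihilate the trajectory form a subspace closed under right
  multiplication by \<open>M\<close>, hence also by \<open>a *\<^sub>R M + mat 1\<close>. Since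
  \<open>matpow\<close> adds factors on the left, the induction absorbs one factor into
  \<open>y\<close>, which must stay arbitrary.\<close>

lemma inner_matpow_linear_trajectory_zero:
  fixes M :: "real^'n^'n"
  assumes x: "linear_trajectory M x0 x" and y: "\<forall>t\<ge>0. y \<bullet> x t = 0"
  shows "\<forall>t\<ge>0. (y v* matpow (a *\<^sub>R M + mat 1) k) \<bullet> x t = 0"
  using y
proof (induction k arbitrary: y)
  case 0
  then show ?case by (simp add: matpow_def)
next
  case (Suc k)
  have "y v* (a *\<^sub>R M + mat 1) = a *\<^sub>R (y v* M) + y"
    by (simp add: vector_matrix_mult_add_rdistrib vector_scaleR_matrix_ac scaleR_vector_matrix_assoc)
  then have "\<forall>t\<ge>0. (y v* (a *\<^sub>R M + mat 1)) \<bullet> x t = 0"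
    using inner_linear_trajectory_zero[OF x Suc.prems] Suc.prems by (simp add: inner_left_distrib)
  from Suc.IH[OF this] show ?case
    by (simp add: matpow_def vector_matrix_mul_assoc)
qed

lemma vector_matrix_mult_mono:
  fixes d c :: "real^'m" and P N :: "real^'n^'m"
  assumes "0 \<le> d" "d \<le> c" "0 \<le> P" "P \<le> N"
  shows "0 \<le> d v* P" "d v* P \<le> c v* N"
proof -
  have "0 \<le> d $ i" "d $ i \<le> c $ i" "0 \<le> P $ i $ j" "P $ i $ j \<le> N $ i $ j" for i j
    using assms by (auto simp: less_eq_vec_def)
  then show "0 \<le> d v* P" "d v* P \<le> c v* N"
    by (auto simp: less_eq_vec_def vector_matrix_mult_def intro!: sum_nonneg sum_mono mult_mono'
        mult_nonneg_nonneg)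
qed

text \<open>Peeling the leftmost factor off both powers replaces \<open>d\<close> and
  \<open>c\<close> by \<open>d v* P\<close> and \<open>c v* N\<close>, which again satisfy the two
  sign conditions; so the induction generalizes over both vectors.\<close>

lemma vector_matpow_mono:
  fixes P N :: "real^'n^'n"
  assumes "0 \<le> d" "d \<le> c" "0 \<le> P" "P \<le> N"
  shows "0 \<le> d v* matpow P k \<and> d v* matpow P k \<le> c v* matpow N k"
  using assms(1,2)
proof (induction k arbitrary: d c)
  case 0
  then show ?case by (simp add: matpow_def)
next
  case (Suc k)
  from Suc.IH[OF vector_matrix_mult_mono[OF Suc.prems assms(3,4)]] show ?case
    by (simp add: matpow_def vector_matrix_mul_assoc)
qed

lemma vector_matrix_mult_sum:
  fixes d :: "real^'m" and Q :: "'i \<Rightarrow> real^'n^'m"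
  shows "d v* (\<Sum>i\<in>I. Q i) = (\<Sum>i\<in>I. d v* Q i)"
  by (induction I rule: infinite_finite_induct)
    (simp_all add: vector_matrix_mult_def vec_eq_iff algebra_simps sum.distrib)

text \<open>The inner product is a sum of nonnegative terms, so a nonpositive total forces each term
  to vanish, and the positive weights can be cancelled.\<close>

lemma inner_pos_nonneg_imp_zero:
  fixes v x :: "real^'n"
  assumes "\<forall>j. 0 < v $ j" "0 \<le> x" "v \<bullet> x \<le> 0"
  shows "x = 0"
proof -
  have "0 \<le> v $ j * x $ j" for j
    using assms(1,2) by (simp add: less_eq_vec_def less_imp_le)
  then have "\<forall>j\<in>UNIV. v $ j * x $ j = 0"
    using assms(3) by (subst sum_nonneg_eq_0_iff[symmetric])
      (auto simp: inner_vec_def intro!: antisym sum_nonneg)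
  then show ?thesis
    using assms(1) by (auto simp: vec_eq_iff) (metis less_irrefl)
qed

lemma inner_mono_left:
  fixes a b x :: "real^'n"
  assumes "a \<le> b" "0 \<le> x"
  shows "a \<bullet> x \<le> b \<bullet> x"
  using assms by (auto simp: inner_vec_def less_eq_vec_def intro!: sum_mono mult_right_mono)

text \<open>Each product of entries is at most its absolute value, which the bound on
  \<open>K\<close> controls. This makes \<open>A - B ** K\<close> dominate the worst case
  \<open>A - \<bar>B\<bar> ** E\<close>, whatever the gain.\<close>

lemma abs_matrix_mult_le:
  fixes B :: "real^'m^'n" and E K :: "real^'k^'m"
  assumes "\<bar>K\<bar> \<le> E"
  shows "B ** K \<le> \<bar>B\<bar> ** E"
proof -
  have "B $ i $ k * K $ k $ j \<le> \<bar>B $ i $ k\<bar> * E $ k $ j" for i j k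
  proof -
    have "\<bar>K $ k $ j\<bar> \<le> E $ k $ j"
      using assms by (simp add: less_eq_vec_def abs_vec_def)
    then have "\<bar>B $ i $ k * K $ k $ j\<bar> \<le> \<bar>B $ i $ k\<bar> * E $ k $ j"
      by (simp add: abs_mult mult_left_mono)
    then show ?thesis by linarith
  qed
  then show ?thesis
    by (auto simp: less_eq_vec_def abs_vec_def matrix_matrix_mult_def intro!: sum_mono)
qed

lemma abs_vector_matrix_mult_le:
  fixes r :: "real^'m" and E K :: "real^'n^'m"
  assumes "\<bar>K\<bar> \<le> E"
  shows "r v* K \<le> \<bar>r\<bar> v* E"
proof -
  have "K $ k $ j * r $ k \<le> E $ k $ j * \<bar>r $ k\<bar>" for j k
  proof -
    have "\<bar>K $ k $ j\<bar> \<le> E $ k $ j"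
      using assms by (simp add: less_eq_vec_def abs_vec_def)
    then have "\<bar>K $ k $ j * r $ k\<bar> \<le> E $ k $ j * \<bar>r $ k\<bar>"
      by (simp add: abs_mult mult_right_mono)
    then show ?thesis by linarith
  qed
  then show ?thesis
    by (auto simp: less_eq_vec_def abs_vec_def vector_matrix_mult_def mult.commute intro!: sum_mono)
qed

theorem theorem9:
  fixes T h :: real
    and A :: "real^'n^'n" and B :: "real^'m^'n" and F :: "real^'l^'n" and E :: "real^'n^'m"
    and s :: "real^'n" and r :: "real^'m" and \<gamma> :: "real^'l" and K :: "real^'n^'m"
  assumes "0 \<le> T"
    and "0 \<le> F" and "0 \<le> E" and "\<forall>i. row i E \<noteq> 0" and "0 \<le> \<gamma>"
    and "metzler (A - \<bar>B\<bar> ** E)"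
    and "transpose E *v \<bar>r\<bar> \<le> s"
    and finite_horizon_value:
      "\<forall>x0\<ge>0. \<bar>minimax_value A B E F s r \<gamma> {0..T} x0\<bar> \<noteq> \<infinity>"
    and finite_horizon_ode:
      "\<exists>p. bellman_ode_solution A B E s r T p \<and> transpose F *v p 0 \<le> \<gamma> \<and>
           (\<forall>q. bellman_ode_solution A B E s r T q \<longrightarrow> (\<forall>t\<in>{0..T}. q t = p t))"
    and infinite_horizon_value:
      "\<forall>x0\<ge>0. \<bar>minimax_value A B E F s r \<gamma> {0..} x0\<bar> \<noteq> \<infinity>"
    and infinite_horizon_equation:
      "\<exists>!p. bellman_equation_solution A B E F s r \<gamma> p \<and>
            (\<forall>q. bellman_equation_solution A B E F s r \<gamma> q \<longrightarrow> p \<le> q)"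
    and "0 \<le> A - \<bar>B\<bar> ** E + h *\<^sub>R mat 1" and "0 < h"
    and "\<forall>j. 0 < ((s - \<bar>r\<bar> v* E) v*
               (\<Sum>i<CARD('n). matpow ((1 / h) *\<^sub>R (A - \<bar>B\<bar> ** E) + mat 1) i)) $ j"
    and "\<bar>K\<bar> \<le> E"
  shows "detectable_on {x. 0 \<le> x} (rowvector (s - r v* K) :: real^'n^1) (A - B ** K)"
proof -
  define c d where "c = s - r v* K" and "d = s - \<bar>r\<bar> v* E"
  define N P where "N = (1 / h) *\<^sub>R (A - B ** K) + mat 1"
    and "P = (1 / h) *\<^sub>R (A - \<bar>B\<bar> ** E) + mat 1"
  have "0 \<le> d"
    using \<open>transpose E *v \<bar>r\<bar> \<le> s\<close> by (simp add: d_def)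
  have "d \<le> c"
    using abs_vector_matrix_mult_le[OF \<open>\<bar>K\<bar> \<le> E\<close>] by (simp add: c_def d_def diff_left_mono)
  \<comment> \<open>The shift by \<open>h\<close> compensates possibly negative diagonal entries:
    \<open>P\<close> is a positive multiple of a matrix assumed nonnegative.\<close>
  have "P = (1 / h) *\<^sub>R (A - \<bar>B\<bar> ** E + h *\<^sub>R mat 1)"
    using \<open>0 < h\<close> by (simp add: P_def scaleR_right_distrib)
  then have "0 \<le> P"
    using \<open>0 < h\<close> \<open>0 \<le> A - \<bar>B\<bar> ** E + h *\<^sub>R mat 1\<close> by (simp add: less_eq_vec_def)
  have "P \<le> N"
    using abs_matrix_mult_le[OF \<open>\<bar>K\<bar> \<le> E\<close>, of B] \<open>0 < h\<close>
    by (simp add: P_def N_def less_eq_vec_def divide_right_mono)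
  show ?thesis
    unfolding detectable_on_def
  proof (intro ballI impI)
    fix x0 :: "real^'n"
    assume "x0 \<in> {x. 0 \<le> x}"
      and "unobservable_state (rowvector (s - r v* K) :: real^'n^1) (A - B ** K) x0"
    then obtain x where "0 \<le> x0" and x: "linear_trajectory (A - B ** K) x0 x"
      and obs: "\<forall>t\<ge>0. (rowvector c :: real^'n^1) *v x t = 0"
      by (auto simp: unobservable_state_def c_def)
    from obs have out: "\<forall>t\<ge>0. c \<bullet> x t = 0"
      by (simp add: vec_eq_iff rowvector_def matrix_vector_mult_def inner_vec_def)
    have "(d v* matpow P k) \<bullet> x0 \<le> 0" for k
    proof -
      \<comment> \<open>Here nonnegativity of the state is essential: it turns the order between row
        vectors into an order between inner products. The right-hand side then vanishes by
        unobservability, read at time 0.\<close>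
      have "(d v* matpow P k) \<bullet> x0 \<le> (c v* matpow N k) \<bullet> x0"
        using vector_matpow_mono[OF \<open>0 \<le> d\<close> \<open>d \<le> c\<close> \<open>0 \<le> P\<close> \<open>P \<le> N\<close>] \<open>0 \<le> x0\<close>
        by (blast intro: inner_mono_left)
      also have "\<dots> = 0"
        using inner_matpow_linear_trajectory_zero[OF x out, of "1 / h" k] x
        by (auto simp: N_def linear_trajectory_def)
      finally show ?thesis .
    qed
    then have "(d v* (\<Sum>i<CARD('n). matpow P i)) \<bullet> x0 \<le> 0"
      by (simp add: vector_matrix_mult_sum inner_sum_left sum_nonpos)
    then have "x0 = 0"
      using assms(14) \<open>0 \<le> x0\<close> unfolding d_def P_def by (blast intro: inner_pos_nonneg_imp_zero)
    \<comment> \<open>Every trajectory from 0 vanishes for all nonnegative times, so its limit is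
      trivially 0.\<close>
    then show "asymptotically_stable_state (A - B ** K) x0"
      unfolding asymptotically_stable_state_def
      by (auto intro!: tendsto_eventually eventually_at_top_linorderI[of 0] linear_trajectory_zero)
  qed
qed

end
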